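(* (1) Every exact dcpo is quasiexact; hence every weak domain is a quasiexact dcpo. (2) Every quasicontinuous domain is a quasiexact dcpo.
   Context: Let $P$ be a poset. For $A\subseteq P$, $\uparrow A=\{x\in P: y\le x \text{ for some } y\in A\}$; write $\uparrow x$ for $A=\{x\}$. Directed sets are nonempty. A dcpo is a poset in which every directed subset has a supremum. Weak way-below: for $x,y\in P$, $x\ll_w y$ iff for every directed $D\subseteq P$ with $\bigvee D=y$ (supremum exists and equals $y$), $D\cap\uparrow x\ne\varnothing$. For $G\subseteq P$ and $y\in P$, $G\ll_w y$ iff for every directed $D\subseteq P$ with $\bigvee D=y$, $D\cap\uparrow G\neq\varnothing$. $P$ is exact if for every $x\in P$ the set $\{y\in P: y\ll_w x\}$ is directed and has supremum $x$. The relation $\ll_w$ is weakly increasing if for all $x,y,z,u\in P$, $x\ll_w y\le z\ll_w u$ implies $x\ll_w z$. A weak domain is an exact dcpo in which $\ll_w$ is weakly increasing. A nonempty family $\mathcal F$ of subsets of $P$ is directed if for all $F_1,F_2\in\mathcal F$ there is $F_3\in\mathcal F$ with $F_3\subseteq\uparrow F_1\cap\uparrow F_2$. $\mathrm{fin}_w(x)=\{F\subseteq P: F\text{ finite}, F\ll_w x\}$. $P$ is quasiexact if for every $x\in P$ the family $\mathrm{fin}_w(x)$ is directed and $\bigcap\{\uparrow F: F\in\mathrm{fin}_w(x)\}=\uparrow x$. For a subset $G$ of a dcpo $P$ and $x\in P$, $G\ll x$ means: for every directed $D\subseteq P$, $\bigvee D\ge x$ implies $d\in\uparrow G$ for some $d\in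 D$. With $\mathrm{fin}(x)=\{F\subseteq P: F\text{ finite}, F\ll x\}$, a dcpo $P$ is a quasicontinuous domain if for every $x\in P$ the family $\mathrm{fin}(x)$ is directed and $\bigcap\{\uparrow F: F\in\mathrm{fin}(x)\}=\uparrow x$. *)

theory Defs
  imports "HOL-Library.Lub_Glb"
begin

text \<open>
  A poset is a carrier set \<open>P\<close>, possibly empty, in a type of class \<open>order\<close>, with the induced order.
  Suprema are taken inside \<open>P\<close>: \<open>isLub P D y\<close> says that the supremum of \<open>D\<close> in \<open>P\<close> exists
  and equals \<open>y\<close> (in particular \<open>y \<in> P\<close>).
\<close>

definition up :: "'a::order set \<Rightarrow> 'a set \<Rightarrow> 'a set" where
  "up P A = {x \<in> P. \<exists>y\<in>A. y \<le> x}"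

definition directed :: "'a::order set \<Rightarrow> 'a set \<Rightarrow> bool" where
  "directed P D \<longleftrightarrow> D \<subseteq> P \<and> D \<noteq> {} \<and> (\<forall>x\<in>D. \<forall>y\<in>D. \<exists>z\<in>D. x \<le> z \<and> y \<le> z)"

definition dcpo :: "'a::order set \<Rightarrow> bool" where
  "dcpo P \<longleftrightarrow> (\<forall>D. directed P D \<longrightarrow> (\<exists>s. isLub P D s))"

definition weakly_way_below :: "'a::order set \<Rightarrow> 'a \<Rightarrow> 'a \<Rightarrow> bool" where
  "weakly_way_below P x y \<longleftrightarrow> (\<forall>D. directed P D \<and> isLub P D y \<longrightarrow> D \<inter> up P {x} \<noteq> {})"

definition set_weakly_way_below :: "'a::order set \<Rightarrow> 'a set \<Rightarrow> 'a \<Rightarrow> bool" where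
  "set_weakly_way_below P G y \<longleftrightarrow> (\<forall>D. directed P D \<and> isLub P D y \<longrightarrow> D \<inter> up P G \<noteq> {})"

definition exact :: "'a::order set \<Rightarrow> bool" where
  "exact P \<longleftrightarrow> (\<forall>x\<in>P. directed P {y \<in> P. weakly_way_below P y x}
                    \<and> isLub P {y \<in> P. weakly_way_below P y x} x)"

definition weakly_increasing :: "'a::order set \<Rightarrow> bool" where
  "weakly_increasing P \<longleftrightarrow> (\<forall>x\<in>P. \<forall>y\<in>P. \<forall>z\<in>P. \<forall>u\<in>P.
     weakly_way_below P x y \<and> y \<le> z \<and> weakly_way_below P z u \<longrightarrow> weakly_way_below P x z)"

definition weak_domain :: "'a::order set \<Rightarrow> bool" where
  "weak_domain P \<longleftrightarrow> dcpo P \<and> exact P \<and> weakly_increasing P"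

definition directed_family :: "'a::order set \<Rightarrow> 'a set set \<Rightarrow> bool" where
  "directed_family P \<F> \<longleftrightarrow> \<F> \<subseteq> Pow P \<and> \<F> \<noteq> {} \<and>
     (\<forall>F1\<in>\<F>. \<forall>F2\<in>\<F>. \<exists>F3\<in>\<F>. F3 \<subseteq> up P F1 \<inter> up P F2)"

definition fin_w :: "'a::order set \<Rightarrow> 'a \<Rightarrow> 'a set set" where
  "fin_w P x = {F. F \<subseteq> P \<and> finite F \<and> set_weakly_way_below P F x}"

definition quasiexact :: "'a::order set \<Rightarrow> bool" where
  "quasiexact P \<longleftrightarrow> (\<forall>x\<in>P. directed_family P (fin_w P x)
                         \<and> (\<Inter>F\<in>fin_w P x. up P F) = up P {x})"

text \<open>Used only when \<open>P\<close> is a dcpo, so that the supremum \<open>s\<close> below always exists.\<close>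

definition set_way_below :: "'a::order set \<Rightarrow> 'a set \<Rightarrow> 'a \<Rightarrow> bool" where
  "set_way_below P G x \<longleftrightarrow>
     (\<forall>D s. directed P D \<and> isLub P D s \<and> x \<le> s \<longrightarrow> (\<exists>d\<in>D. d \<in> up P G))"

definition fin_wb :: "'a::order set \<Rightarrow> 'a \<Rightarrow> 'a set set" where
  "fin_wb P x = {F. F \<subseteq> P \<and> finite F \<and> set_way_below P F x}"

definition quasicontinuous_domain :: "'a::order set \<Rightarrow> bool" where
  "quasicontinuous_domain P \<longleftrightarrow> dcpo P \<and>
     (\<forall>x\<in>P. directed_family P (fin_wb P x) \<and> (\<Inter>F\<in>fin_wb P x. up P F) = up P {x})"

end

(* Exact posets: a set F weakly way below x meets the directed set of all y weakly way below x,
   so the singletons of that set already refine fin_w x.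

   Quasicontinuous domains: for F weakly way below x, Rudin's lemma is applied to the traces of
   the members of fin_wb x on the principal ideal of x, minus up F. Were these all nonempty,
   there would be a directed set below x that avoids up F and has supremum exactly x; the trace on
   the ideal is what turns "supremum at least x" into the equality that the weak relation needs.
   Hence some trace lies in up F, and such traces are themselves weakly way below x. *)

theory Submission
  imports Defs
begin

lemma isLub_iff:
  "isLub P D s \<longleftrightarrow> s \<in> P \<and> (\<forall>d\<in>D. d \<le> s) \<and> (\<forall>u\<in>P. (\<forall>d\<in>D. d \<le> u) \<longrightarrow> s \<le> u)"
  unfolding isLub_def leastP_def isUb_def setle_def setge_def by auto

lemma mem_up: "z \<in> up P A \<longleftrightarrow> z \<in> P \<and> (\<exists>a\<in>A. a \<le> z)"
  by (simp add: up_def)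

lemma up_up_subset: "A \<subseteq> up P B \<Longrightarrow> up P A \<subseteq> up P B"
  by (auto simp: mem_up subset_iff) (meson order_trans)

lemma directed_family_directed:
  assumes "directed_family P \<F>" "F1 \<in> \<F>" "F2 \<in> \<F>"
  obtains F3 where "F3 \<in> \<F>" "F3 \<subseteq> up P F1" "F3 \<subseteq> up P F2"
  using assms unfolding directed_family_def by (meson le_inf_iff)

text \<open>Zorn's lemma enlarges the discarded set \<open>R\<close> while two things persist: no
  member of the family is swallowed, and whenever \<open>G\<close> refines \<open>F\<close>, every
  survivor in \<open>G\<close> stays above a survivor in \<open>F\<close>. Maximality makes each
  survivor a lower bound of all survivors of some member, and a common refinement then yields upper
  bounds of pairs.\<close>

theorem Rudin:
  assumes dir: "directed_family P \<F>"
    and fin: "\<And>F. F \<in> \<F> \<Longrightarrow> finite F"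
    and ne: "\<And>F. F \<in> \<F> \<Longrightarrow> F \<noteq> {}"
  obtains D where "directed P D" "D \<subseteq> \<Union>\<F>" "\<And>F. F \<in> \<F> \<Longrightarrow> D \<inter> F \<noteq> {}"
proof -
  \<comment> \<open>The sets \<open>R\<close> are complements: the directed set is what a maximal \<open>R\<close> leaves over.\<close>
  define \<A> where "\<A> = {R. (\<forall>F\<in>\<F>. \<not> F \<subseteq> R) \<and>
    (\<forall>F\<in>\<F>. \<forall>G\<in>\<F>. G \<subseteq> up P F \<longrightarrow> (\<forall>z\<in>G - R. \<exists>g\<in>F - R. g \<le> z))}"
  have "{} \<in> \<A>"
    using ne by (auto simp: \<A>_def mem_up)
  moreover have "\<Union>\<C> \<in> \<A>" if "\<C> \<noteq> {}" "subset.chain \<A> \<C>" for \<C>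
  proof -
    \<comment> \<open>Both conditions on \<open>R\<close> can fail only through a finite set
      contained in \<open>R\<close>, and a finite subset of the union of a chain already lies in one
      link.\<close>
    have sub: "\<exists>R\<in>\<C>. R \<in> \<A> \<and> B \<subseteq> R" if "finite B" "B \<subseteq> \<Union>\<C>" for B
    proof -
      obtain R where "R \<in> \<C>" "B \<subseteq> R"
        using finite_subset_Union_chain[OF \<open>finite B\<close> \<open>B \<subseteq> \<Union>\<C>\<close> \<open>\<C> \<noteq> {}\<close> \<open>subset.chain \<A> \<C>\<close>] .
      with \<open>subset.chain \<A> \<C>\<close> show ?thesis unfolding subset.chain_def by blast
    qed
    have "\<not> F \<subseteq> \<Union>\<C>" if "F \<in> \<F>" for F
      using sub[OF fin[OF that]] that by (auto simp: \<A>_def)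
    moreover have "\<exists>g\<in>F - \<Union>\<C>. g \<le> z"
      if FG: "F \<in> \<F>" "G \<in> \<F>" "G \<subseteq> up P F" and z: "z \<in> G - \<Union>\<C>" for F G z
    proof (rule ccontr)
      assume "\<not> ?thesis"
      \<comment> \<open>The elements of \<open>F\<close> below \<open>z\<close> form a finite set,
        so one link would contain them all, although \<open>z\<close> survives that link.\<close>
      then have "{g \<in> F. g \<le> z} \<subseteq> \<Union>\<C>" by blast
      then obtain R where R: "R \<in> \<C>" "R \<in> \<A>" "{g \<in> F. g \<le> z} \<subseteq> R"
        using sub[of "{g \<in> F. g \<le> z}"] fin[OF FG(1)] by auto
      from R(1) z have "z \<in> G - R" by blast
      with R(2) FG have "\<exists>g\<in>F - R. g \<le> z" unfolding \<A>_def by blast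
      with R(3) show False by blast
    qed
    ultimately show ?thesis
      unfolding \<A>_def by (intro CollectI conjI ballI impI)
  qed
  ultimately have "\<exists>R\<in>\<A>. \<forall>X\<in>\<A>. R \<subseteq> X \<longrightarrow> X = R"
    by (intro subset_Zorn_nonempty) auto
  then obtain R where R: "R \<in> \<A>" and max: "\<And>X. X \<in> \<A> \<Longrightarrow> R \<subseteq> X \<Longrightarrow> X = R"
    by metis
  have R1: "F - R \<noteq> {}" if "F \<in> \<F>" for F
    using R that by (auto simp: \<A>_def)
  have R2: "\<exists>g\<in>F - R. g \<le> z" if "F \<in> \<F>" "G \<in> \<F>" "G \<subseteq> up P F" "z \<in> G - R" for F G z
    using R that unfolding \<A>_def by blast
  \<comment> \<open>Discarding everything above \<open>x\<close> as well keeps the second condition,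
    since a point below some \<open>z\<close> that is not above \<open>x\<close> is not above
    \<open>x\<close> either. By maximality the first condition must fail for the larger set, so some
    member survives only above \<open>x\<close>.\<close>
  have above: "\<exists>F\<in>\<F>. \<forall>z\<in>F - R. x \<le> z" if "x \<notin> R" for x
  proof (rule ccontr)
    assume *: "\<not> ?thesis"
    have "R \<union> {z. x \<le> z} \<in> \<A>"
      unfolding \<A>_def
    proof (intro CollectI conjI ballI impI)
      fix F assume "F \<in> \<F>"
      with * show "\<not> F \<subseteq> R \<union> {z. x \<le> z}" by blast
    next
      fix F G z
      assume "F \<in> \<F>" "G \<in> \<F>" "G \<subseteq> up P F" and z: "z \<in> G - (R \<union> {z. x \<le> z})"
      then obtain g where "g \<in> F - R" "g \<le> z" using R2[of F G z] by blast
      then show "\<exists>g\<in>F - (R \<union> {z. x \<le> z}). g \<le> z"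
        using z by (auto intro: order_trans)
    qed
    then have "R \<union> {z. x \<le> z} = R" using max by blast
    with that show False by blast
  qed
  have "\<exists>w\<in>\<Union>\<F> - R. x \<le> w \<and> y \<le> w" if "x \<in> \<Union>\<F> - R" "y \<in> \<Union>\<F> - R" for x y
  proof -
    obtain F1 F2 where F1: "F1 \<in> \<F>" "\<forall>z\<in>F1 - R. x \<le> z" and F2: "F2 \<in> \<F>" "\<forall>z\<in>F2 - R. y \<le> z"
      using above \<open>x \<in> \<Union>\<F> - R\<close> \<open>y \<in> \<Union>\<F> - R\<close> by (meson DiffD2)
    obtain F3 where F3: "F3 \<in> \<F>" "F3 \<subseteq> up P F1" "F3 \<subseteq> up P F2"
      using directed_family_directed[OF dir F1(1) F2(1)] .
    obtain w where w: "w \<in> F3 - R" using R1[OF F3(1)] by blast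
    \<comment> \<open>Each \<open>Fi\<close> has a survivor below \<open>w\<close>, and all
      survivors of \<open>F1\<close> lie above \<open>x\<close>, those of \<open>F2\<close> above
      \<open>y\<close>.\<close>
    have "x \<le> w" "y \<le> w"
      using R2[OF F1(1) F3(1,2) w] R2[OF F2(1) F3(1,3) w] F1(2) F2(2)
      by (meson order_trans)+
    with w F3(1) show ?thesis by blast
  qed
  moreover obtain F where "F \<in> \<F>"
    using dir unfolding directed_family_def by blast
  then have "\<Union>\<F> - R \<noteq> {}" using R1[of F] by blast
  moreover have "\<Union>\<F> - R \<subseteq> P"
    using dir unfolding directed_family_def by blast
  ultimately have "directed P (\<Union>\<F> - R)"
    unfolding directed_def by blast
  moreover have "(\<Union>\<F> - R) \<inter> F \<noteq> {}" if "F \<in> \<F>" for F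
    using R1[OF that] that by blast
  ultimately show thesis
    by (intro that[of "\<Union>\<F> - R"]) auto
qed

text \<open>The singleton of \<open>x\<close> is directed with supremum \<open>x\<close>, so it has
  to meet \<open>up P F\<close>.\<close>

lemma set_weakly_way_below_self:
  assumes "x \<in> P" "set_weakly_way_below P F x"
  shows "x \<in> up P F"
proof -
  have "directed P {x}" "isLub P {x} x"
    using assms(1) by (auto simp: directed_def isLub_iff)
  with assms(2) show ?thesis unfolding set_weakly_way_below_def by blast
qed

text \<open>This half of the intersection condition holds in every poset, which leaves only the
  reverse inclusion for the two implications.\<close>

lemma up_singleton_subset_fin_w:
  assumes "x \<in> P"
  shows "up P {x} \<subseteq> (\<Inter>F\<in>fin_w P x. up P F)"
  using set_weakly_way_below_self[OF assms] up_up_subset[of "{x}"] by (auto simp: fin_w_def)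

lemma fin_wb_subset_fin_w: "fin_wb P x \<subseteq> fin_w P x"
  unfolding fin_wb_def fin_w_def set_way_below_def set_weakly_way_below_def by blast

lemma exact_imp_quasiexact:
  assumes "exact P"
  shows "quasiexact P"
  unfolding quasiexact_def
proof
  fix x assume x: "x \<in> P"
  define D where "D = {y \<in> P. weakly_way_below P y x}"
  have D: "directed P D" "isLub P D x"
    using assms x by (auto simp: exact_def D_def)
  have single: "{d} \<in> fin_w P x" if "d \<in> D" for d
    using that by (auto simp: D_def fin_w_def weakly_way_below_def set_weakly_way_below_def)
  have "\<exists>F3\<in>fin_w P x. F3 \<subseteq> up P F1 \<inter> up P F2" if F: "F1 \<in> fin_w P x" "F2 \<in> fin_w P x" for F1 F2
  proof -
    obtain d1 d2 where d: "d1 \<in> D" "d1 \<in> up P F1" "d2 \<in> D" "d2 \<in> up P F2"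
      using F D unfolding fin_w_def set_weakly_way_below_def by blast
    then obtain d3 where d3: "d3 \<in> D" "d1 \<le> d3" "d2 \<le> d3"
      using D(1) unfolding directed_def by blast
    with d have "{d3} \<subseteq> up P F1 \<inter> up P F2"
      by (auto simp: mem_up D_def intro: order_trans)
    with single[OF d3(1)] show ?thesis by blast
  qed
  moreover obtain d where d: "d \<in> D" using D(1) by (auto simp: directed_def)
  ultimately have "directed_family P (fin_w P x)"
    using single[OF d] unfolding directed_family_def by (auto simp: fin_w_def)
  moreover have "(\<Inter>F\<in>fin_w P x. up P F) \<subseteq> up P {x}"
  proof
    fix z assume "z \<in> (\<Inter>F\<in>fin_w P x. up P F)"
    \<comment> \<open>The singletons alone suffice here: they make \<open>z\<close> an upper bound
      of \<open>D\<close>, hence above its supremum \<open>x\<close>.\<close>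
    then have "z \<in> up P {d}" if "d \<in> D" for d using single[OF that] by blast
    then have "z \<in> P" "\<forall>d\<in>D. d \<le> z" using d by (auto simp: mem_up)
    with D(2) show "z \<in> up P {x}" by (simp add: isLub_iff mem_up)
  qed
  ultimately show "directed_family P (fin_w P x) \<and> (\<Inter>F\<in>fin_w P x. up P F) = up P {x}"
    using up_singleton_subset_fin_w[OF x] by blast
qed

text \<open>A directed set with supremum \<open>x\<close> lies below \<open>x\<close>, so any
  element of \<open>F\<close> found under one of its members is itself below \<open>x\<close> and
  survives the restriction.\<close>

lemma fin_wb_trace:
  assumes "F \<in> fin_wb P x"
  shows "F \<inter> {..x} \<in> fin_w P x"
proof -
  have "D \<inter> up P (F \<inter> {..x}) \<noteq> {}" if "directed P D" "isLub P D x" for D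
  proof -
    have "D \<inter> up P F \<noteq> {}"
      using assms that unfolding fin_wb_def set_way_below_def by blast
    then obtain d f where "d \<in> D" "d \<in> P" "f \<in> F" "f \<le> d" by (auto simp: mem_up)
    moreover from this that(2) have "f \<le> x" by (auto simp: isLub_iff intro: order_trans)
    ultimately have "d \<in> up P (F \<inter> {..x})" by (auto simp: mem_up)
    with \<open>d \<in> D\<close> show ?thesis by blast
  qed
  with assms show ?thesis by (auto simp: fin_w_def fin_wb_def set_weakly_way_below_def)
qed

lemma trace_refines:
  assumes "quasicontinuous_domain P" "x \<in> P" "F \<in> fin_w P x"
  obtains G where "G \<in> fin_wb P x" "G \<inter> {..x} \<subseteq> up P F"
proof (rule ccontr)
  assume "\<not> thesis"
  with that have none: "\<not> G \<inter> {..x} \<subseteq> up P F" if "G \<in> fin_wb P x" for G using that by blast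
  have dir: "directed_family P (fin_wb P x)" and int: "(\<Inter>F\<in>fin_wb P x. up P F) = up P {x}"
    using assms by (auto simp: quasicontinuous_domain_def)
  define tr where "tr G = G \<inter> {..x} - up P F" for G
  \<comment> \<open>A point \<open>g\<close> below \<open>z\<close> inherits
    \<open>g \<le> x\<close>, and it avoids \<open>up P F\<close> because that set is upward closed.
    Hence refinements pass to the reduced traces, which form a directed family.\<close>
  have tr_mono: "tr K \<subseteq> up P (tr G)" if "K \<subseteq> up P G" for K G
  proof
    fix z assume "z \<in> tr K"
    then have z: "z \<in> K" "z \<le> x" "z \<notin> up P F" by (auto simp: tr_def)
    with that have "z \<in> up P G" by blast
    then obtain g where g: "g \<in> G" "g \<le> z" "z \<in> P" by (auto simp: mem_up)
    with z have "g \<in> tr G" by (auto simp: tr_def mem_up intro: order_trans)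
    with g show "z \<in> up P (tr G)" by (auto simp: mem_up)
  qed
  have "directed_family P (tr ` fin_wb P x)"
    unfolding directed_family_def
  proof (intro conjI ballI)
    show "tr ` fin_wb P x \<subseteq> Pow P" by (auto simp: tr_def fin_wb_def)
    show "tr ` fin_wb P x \<noteq> {}" using dir by (simp add: directed_family_def)
  next
    fix T1 T2 assume "T1 \<in> tr ` fin_wb P x" "T2 \<in> tr ` fin_wb P x"
    then obtain G1 G2 where G: "G1 \<in> fin_wb P x" "T1 = tr G1" "G2 \<in> fin_wb P x" "T2 = tr G2"
      by blast
    obtain G3 where "G3 \<in> fin_wb P x" "G3 \<subseteq> up P G1" "G3 \<subseteq> up P G2"
      using directed_family_directed[OF dir G(1,3)] .
    with tr_mono G show "\<exists>T3\<in>tr ` fin_wb P x. T3 \<subseteq> up P T1 \<inter> up P T2"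
      by blast
  qed
  moreover have "finite T" "T \<noteq> {}" if "T \<in> tr ` fin_wb P x" for T
    using that none by (auto simp: tr_def fin_wb_def)
  ultimately obtain D where D: "directed P D" "D \<subseteq> \<Union>(tr ` fin_wb P x)"
    and meets: "\<And>T. T \<in> tr ` fin_wb P x \<Longrightarrow> D \<inter> T \<noteq> {}"
    using Rudin[of P "tr ` fin_wb P x"] by blast
  obtain s where s: "isLub P D s"
    using assms(1) D(1) by (auto simp: quasicontinuous_domain_def dcpo_def)
  \<comment> \<open>\<open>D\<close> meets every reduced trace, so \<open>s\<close> lies above an
    element of each \<open>G\<close> and therefore above \<open>x\<close>; conversely
    \<open>D\<close> consists of trace elements, all below \<open>x\<close>.\<close>
  have "s \<in> up P G" if G: "G \<in> fin_wb P x" for G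
  proof -
    obtain d where "d \<in> D" "d \<in> tr G" using meets G by blast
    with s show ?thesis by (auto simp: mem_up isLub_iff tr_def)
  qed
  with int have "s \<in> up P {x}" by blast
  moreover have "s \<le> x"
    using s D(2) assms(2) by (auto simp: isLub_iff tr_def)
  ultimately have "isLub P D x" using s by (auto simp: mem_up)
  with assms(3) D(1) have "D \<inter> up P F \<noteq> {}"
    by (auto simp: fin_w_def set_weakly_way_below_def)
  with D(2) show False by (auto simp: tr_def)
qed

lemma quasicontinuous_imp_quasiexact:
  assumes "quasicontinuous_domain P"
  shows "quasiexact P"
  unfolding quasiexact_def
proof
  fix x assume x: "x \<in> P"
  have dir: "directed_family P (fin_wb P x)" and int: "(\<Inter>F\<in>fin_wb P x. up P F) = up P {x}"
    using assms x by (auto simp: quasicontinuous_domain_def)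
  have "\<exists>F3\<in>fin_w P x. F3 \<subseteq> up P F1 \<inter> up P F2" if F: "F1 \<in> fin_w P x" "F2 \<in> fin_w P x" for F1 F2
  proof -
    obtain G1 where G1: "G1 \<in> fin_wb P x" "G1 \<inter> {..x} \<subseteq> up P F1"
      using trace_refines[OF assms x F(1)] .
    obtain G2 where G2: "G2 \<in> fin_wb P x" "G2 \<inter> {..x} \<subseteq> up P F2"
      using trace_refines[OF assms x F(2)] .
    obtain G3 where G3: "G3 \<in> fin_wb P x" "G3 \<subseteq> up P G1" "G3 \<subseteq> up P G2"
      using directed_family_directed[OF dir G1(1) G2(1)] .
    \<comment> \<open>A point of \<open>G1\<close> or \<open>G2\<close> lying under an element of
      \<open>G3\<close> that is below \<open>x\<close> is itself below \<open>x\<close>, so traces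
      inherit the refinement.\<close>
    have "G3 \<inter> {..x} \<subseteq> up P (G1 \<inter> {..x})" "G3 \<inter> {..x} \<subseteq> up P (G2 \<inter> {..x})"
      using G3(2,3) by (fastforce simp: up_def intro: order_trans)+
    with up_up_subset[OF G1(2)] up_up_subset[OF G2(2)]
    have "G3 \<inter> {..x} \<subseteq> up P F1 \<inter> up P F2" by blast
    with fin_wb_trace[OF G3(1)] show ?thesis by blast
  qed
  moreover have "fin_w P x \<noteq> {}"
    using dir fin_wb_subset_fin_w[of P x] by (auto simp: directed_family_def)
  ultimately have "directed_family P (fin_w P x)"
    unfolding directed_family_def by (auto simp: fin_w_def)
  \<comment> \<open>\<open>fin_w P x\<close> contains \<open>fin_wb P x\<close>, so intersecting
    over it can only give a smaller set.\<close>
  moreover have "(\<Inter>F\<in>fin_w P x. up P F) \<subseteq> up P {x}"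
    using int fin_wb_subset_fin_w[of P x] by blast
  ultimately show "directed_family P (fin_w P x) \<and> (\<Inter>F\<in>fin_w P x. up P F) = up P {x}"
    using up_singleton_subset_fin_w[OF x] by blast
qed

theorem proposition3p13:
  fixes P :: "'a::order set"
  shows "(dcpo P \<and> exact P \<longrightarrow> quasiexact P)
       \<and> (weak_domain P \<longrightarrow> dcpo P \<and> quasiexact P)
       \<and> (quasicontinuous_domain P \<longrightarrow> dcpo P \<and> quasiexact P)"
  using exact_imp_quasiexact[of P] quasicontinuous_imp_quasiexact[of P]
  unfolding weak_domain_def quasicontinuous_domain_def by blast

end
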